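(* Let $m,n$ be integers with $n\ge 2$ and $m-n\geq 4$, such that $m$ and $n$ are both even or both odd. Then the metric dimension of the generalized Möbius ladder $M_{m,n}$ is $4$, i.e. $\dim(M_{m,n})=4$.
   Context: Generalized Möbius ladder: let $P_m$ and $P_n$ be the paths on vertices $u_1,\ldots,u_m$ and $v_1,\ldots,v_n$ respectively (consecutive vertices adjacent), and let $P_m\times P_n$ be their Cartesian product. The graph $M_{m,n}$ is obtained from $P_m\times P_n$ by a $180^\circ$ twist and identification of the two ends: for each $1\le j\le n$ the vertex $(u_1,v_j)$ is identified with the vertex $(u_m,v_{n+1-j})$, and for each $1\le j\le n-1$ the edge joining $(u_1,v_j)$ and $(u_1,v_{j+1})$ is identified with the edge joining $(u_m,v_{n+1-j})$ and $(u_m,v_{n-j})$. Equivalently, writing $v_{i,j}$ for $(u_i,v_j)$, $M_{m,n}$ is the simple graph with vertex set $\{v_{i,j} : 1\le i\le m-1,\ 1\le j\le n\}$ and edges: $v_{i,j}v_{i,j+1}$ for $1\le i\le m-1$, $1\le j\le n-1$; $v_{i,j}v_{i+1,j}$ for $1\le i\le m-2$, $1\le j\le n$; and $v_{m-1,j}v_{1,n+1-j}$ for $1\le j\le n$. Metric dimension: for a connected graph $G$, $d(u,v)$ denotes the length (number of edges) of a shortest path between $u$ and $v$. For an ordered set $W=\{w_1,\ldots,w_k\}$ of vertices of $G$, the representation of a vertex $v$ with respect to $W$ is the $k$-tuple $(d(v,w_1),\ldots,d(v,w_k))$. $W$ is a resolving set for $G$ if distinct vertices of $G$ have distinct representations with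 respect to $W$. The metric dimension $\dim(G)$ is the minimum cardinality of a resolving set of $G$. *)

theory Defs
  imports "Graph_Theory.Graph_Theory"
begin

text \<open>Undirected graphs are rendered, as in \<^theory>\<open>Graph_Theory.Digraph\<close>, by symmetric digraphs:
  an edge is a pair of opposite arcs, so the length of a path is its number of arcs.\<close>

text \<open>The value is unspecified if no path from \<open>u\<close> to \<open>v\<close> exists.\<close>

definition graph_dist :: "('a, 'b) pre_digraph \<Rightarrow> 'a \<Rightarrow> 'a \<Rightarrow> nat" where
  "graph_dist G u v = (LEAST k. \<exists>p. pre_digraph.apath G u p v \<and> length p = k)"

definition representation :: "('a, 'b) pre_digraph \<Rightarrow> 'a list \<Rightarrow> 'a \<Rightarrow> nat list" where
  "representation G W v = map (graph_dist G v) W"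

text \<open>Ordered sets of vertices are lists without repetition.\<close>

definition resolving_set :: "('a, 'b) pre_digraph \<Rightarrow> 'a list \<Rightarrow> bool" where
  "resolving_set G W \<longleftrightarrow>
     distinct W \<and> set W \<subseteq> verts G \<and> inj_on (representation G W) (verts G)"

definition metric_dimension :: "('a, 'b) pre_digraph \<Rightarrow> nat" where
  "metric_dimension G = (LEAST k. \<exists>W. resolving_set G W \<and> length W = k)"

text \<open>The pair \<open>(i, j)\<close> stands for the vertex $v_{i,j}$. The three sets list each edge in one
  direction: along the copies of $P_n$, along the copies of $P_m$, and across the twisted seam
  where the column $i = m$ is identified with the reversed column $i = 1$.\<close>

definition moebius_edges :: "nat \<Rightarrow> nat \<Rightarrow> ((nat \<times> nat) \<times> (nat \<times> nat)) set" where
  "moebius_edges m n =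
     {((i, j), (i, j + 1)) | i j. 1 \<le> i \<and> i \<le> m - 1 \<and> 1 \<le> j \<and> j \<le> n - 1} \<union>
     {((i, j), (i + 1, j)) | i j. 1 \<le> i \<and> i \<le> m - 2 \<and> 1 \<le> j \<and> j \<le> n} \<union>
     {((m - 1, j), (1, n + 1 - j)) | j. 1 \<le> j \<and> j \<le> n}"

definition moebius_ladder :: "nat \<Rightarrow> nat \<Rightarrow> (nat \<times> nat) pair_pre_digraph" where
  "moebius_ladder m n =
     \<lparr> pverts = {1..m - 1} \<times> {1..n}, parcs = moebius_edges m n \<union> (moebius_edges m n)\<inverse> \<rparr>"

lemma (in wf_digraph) graph_dist_eq_mu:
  assumes "u \<rightarrow>\<^sup>*\<^bsub>G\<^esub> v"
  shows "ereal (real (graph_dist G u v)) = \<mu> (\<lambda>_. 1) u v"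
proof -
  have cost: "awalk_cost (\<lambda>_. 1) p = real (length p)" for p :: "'b list"
    by (induct p) auto
  let ?P = "\<lambda>k. \<exists>p. apath u p v \<and> length p = k"
  from assms obtain p where "awalk u p v"
    by (auto simp: reachable_awalk)
  then have "?P (length (awalk_to_apath p))"
    using apath_awalk_to_apath by blast
  then have "?P (graph_dist G u v)"
    unfolding graph_dist_def by (rule LeastI)
  then obtain q where q: "awalk u q v" "length q = graph_dist G u v"
    by (auto simp: apath_def)
  have lower: "graph_dist G u v \<le> length p" if "awalk u p v" for p
  proof -
    have "graph_dist G u v \<le> length (awalk_to_apath p)"
      unfolding graph_dist_def using apath_awalk_to_apath[OF that] by (auto intro: Least_le)
    also have "\<dots> \<le> length p"
      using that
    proof (induct rule: awalk_to_apath_induct)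
      case (path p)
      then have "awalk_to_apath p = p"
        by (auto simp: awalk_to_apath.simps)
      then show ?case by simp
    next
      case (decomp p q r s)
      from decomp(2,1,3) have "p = q @ r @ s"
        by (rule awalk_cyc_decompE)
      moreover have "awalk_to_apath p = awalk_to_apath (q @ s)"
        using decomp(1-3) by (rule step_awalk_to_apath)
      ultimately show ?case using decomp(4) by simp
    qed
    finally show ?thesis .
  qed
  show ?thesis
    unfolding \<mu>_def cost
  proof (rule INF_eqI[symmetric])
    show "ereal (real (graph_dist G u v)) \<le> ereal (real (length p))"
      if "p \<in> {p. awalk u p v}" for p
      using lower that by simp
    show "y \<le> ereal (real (graph_dist G u v))"
      if "\<And>p. p \<in> {p. awalk u p v} \<Longrightarrow> y \<le> ereal (real (length p))" for y
      using that[of q] q by simp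
  qed
qed

lemma pair_graph_moebius_ladder:
  assumes "m \<ge> 3"
  shows "pair_graph (moebius_ladder m n)"
proof unfold_locales
  let ?G = "moebius_ladder m n"
  have sub: "parcs ?G \<subseteq> pverts ?G \<times> pverts ?G"
    using assms by (auto simp: moebius_ladder_def moebius_edges_def)
  then show "e \<in> parcs ?G \<Longrightarrow> fst e \<in> pverts ?G" "e \<in> parcs ?G \<Longrightarrow> snd e \<in> pverts ?G" for e
    by auto
  show fin: "finite (pverts ?G)"
    by (simp add: moebius_ladder_def)
  show "finite (parcs ?G)"
    by (rule finite_subset[OF sub]) (simp add: fin)
  show "e \<in> parcs ?G \<Longrightarrow> fst e \<noteq> snd e" for e
    using assms by (auto simp: moebius_ladder_def moebius_edges_def)
  show "symmetric ?G"
    by (auto simp: symmetric_def moebius_ladder_def sym_def)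
qed

lemma strongly_connected_moebius_ladder:
  assumes "m \<ge> 3" "n \<ge> 1"
  shows "strongly_connected (with_proj (moebius_ladder m n))"
proof -
  let ?G = "with_proj (moebius_ladder m n)"
  interpret pair_graph "moebius_ladder m n"
    using assms(1) by (rule pair_graph_moebius_ladder)
  have base: "(1, 1) \<rightarrow>\<^sup>*\<^bsub>?G\<^esub> (1, 1)"
    using assms by (intro reachable_refl) (auto simp: moebius_ladder_def)
  have row: "(1, 1) \<rightarrow>\<^sup>*\<^bsub>?G\<^esub> (1, Suc j)" if "Suc j \<le> n" for j
    using that
  proof (induct j)
    case (Suc j)
    then have "(1, Suc j) \<rightarrow>\<^bsub>?G\<^esub> (1, Suc (Suc j))"
      using assms by (auto simp: moebius_ladder_def moebius_edges_def)
    with Suc show ?case by (auto intro: reachable_adj_trans)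
  qed (use base in simp)
  have "(1, 1) \<rightarrow>\<^sup>*\<^bsub>?G\<^esub> (Suc i, Suc j)" if "Suc i \<le> m - 1" "Suc j \<le> n" for i j
    using that
  proof (induct i)
    case (Suc i)
    then have "(Suc i, Suc j) \<rightarrow>\<^bsub>?G\<^esub> (Suc (Suc i), Suc j)"
      by (auto simp: moebius_ladder_def moebius_edges_def)
    with Suc show ?case by (auto intro: reachable_adj_trans)
  qed (use row in simp)
  note reach = this
  have from_base: "(1, 1) \<rightarrow>\<^sup>*\<^bsub>?G\<^esub> v" if "v \<in> verts ?G" for v
    using that reach[of "fst v - 1" "snd v - 1"] by (cases v) (auto simp: moebius_ladder_def)
  have sym: "symmetric ?G"
    by (rule pair_sym_arcs)
  have "u \<rightarrow>\<^sup>*\<^bsub>?G\<^esub> v" if "u \<in> verts ?G" "v \<in> verts ?G" for u v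
    using from_base that symmetric_reachable[OF sym] reachable_trans by blast
  moreover have "verts ?G \<noteq> {}"
    using assms by (auto simp: moebius_ladder_def)
  ultimately show ?thesis
    by (simp add: strongly_connected_def)
qed

end

theory Submission
  imports Defs
begin

text \<open>
  Unroll the band to the strip \<open>\<int> \<times> {1..n}\<close>, where \<open>(x + L, y)\<close> and \<open>(x, n + 1 - y)\<close> with
  \<open>L = m - 1\<close> are the same vertex. The distance is the smaller of two Manhattan distances,
  \<open>\<bar>x - p\<bar> + \<bar>y - h\<bar>\<close> and \<open>L - \<bar>x - p\<bar> + \<bar>y + h - (n + 1)\<bar>\<close>, and since \<open>L + n\<close> is odd the
  graph is bipartite.

  The four corners resolve: up to the reflection \<open>t \<mapsto> L + n - 1 - t\<close>, the two distances to opposite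
  corners at \<open>x = 0\<close> and \<open>x = L - 1\<close> are \<open>i + j - 2\<close> and \<open>i + j - 1\<close>, which together determine
  \<open>i + j\<close>; the other two corners determine \<open>i - j\<close>.

  Three vertices never resolve. A vertex separates the ends of at most one diagonal of a unit
  square. In a central row of squares a vertex off the middle line fails on the antidiagonal along
  a half turn of length \<open>L\<close>, on the main diagonal along the next one, and on both diagonals of one
  square near the middle of each half turn. For three such vertices, either one half turn is shared,
  or else the gaps between them force one of these doubly unseparated squares to lie where the other
  two fail on a common diagonal. A vertex on the middle line (\<open>n\<close> odd) fails with period \<open>L\<close>
  instead; one such vertex is again handled by squares, up to the case where all three vertices share
  a column and do not separate its left and right neighbours. Two or three such vertices do not
  separate the points directly above and below the middle line in any column, and neither does the
  remaining vertex in the column half a band length away from it.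
\<close>

text \<open>The landmark has a lift at \<open>p\<close>, \<open>l\<close> is the length of the band, and \<open>s\<close> is the square
  between the columns \<open>s\<close> and \<open>s + 1\<close>; the predicates collect squares whose antidiagonal
  (main diagonal) the landmark does not separate. The isolated squares \<open>p - 1 - z\<close> and \<open>p + z\<close> lie
  on the border between the regions where the two Manhattan distances are the smaller one.\<close>

definition antidiagonal :: "int \<Rightarrow> int \<Rightarrow> int \<Rightarrow> int \<Rightarrow> bool" where
  "antidiagonal l z p s \<longleftrightarrow>
     (\<exists>k. p + 2 * l * k \<le> s \<and> s < p + 2 * l * k + l \<or> s = p + 2 * l * k - 1 - z)"

definition main_diagonal :: "int \<Rightarrow> int \<Rightarrow> int \<Rightarrow> int \<Rightarrow> bool" where
  "main_diagonal l z p s \<longleftrightarrow>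
     (\<exists>k. p + 2 * l * k + l \<le> s \<and> s < p + 2 * l * k + 2 * l \<or> s = p + 2 * l * k + z)"

section \<open>Common unseparated squares of two or three landmarks on the integer line\<close>

lemma antidiagonalI:
  "p \<le> s \<Longrightarrow> s < p + l \<Longrightarrow> antidiagonal l z p s"
  "p + 2 * l \<le> s \<Longrightarrow> s < p + 3 * l \<Longrightarrow> antidiagonal l z p s"
  "p - 2 * l \<le> s \<Longrightarrow> s < p - l \<Longrightarrow> antidiagonal l z p s"
  "s = p - 1 - z \<Longrightarrow> antidiagonal l z p s"
  unfolding antidiagonal_def
  by (rule exI[of _ 0], simp) (rule exI[of _ 1], simp, rule exI[of _ "-1"], simp, rule exI[of _ 0], simp)

lemma main_diagonalI:
  "p + l \<le> s \<Longrightarrow> s < p + 2 * l \<Longrightarrow> main_diagonal l z p s"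
  "p + 3 * l \<le> s \<Longrightarrow> s < p + 4 * l \<Longrightarrow> main_diagonal l z p s"
  "p - l \<le> s \<Longrightarrow> s < p \<Longrightarrow> main_diagonal l z p s"
  "s = p + z \<Longrightarrow> main_diagonal l z p s"
  unfolding main_diagonal_def
  by (rule exI[of _ 0], simp) (rule exI[of _ 1], simp, rule exI[of _ "-1"], simp, rule exI[of _ 0], simp)

text \<open>On the circle of length \<open>2 * l\<close> a cyclic gap larger than \<open>l\<close>
  confines the three landmarks to less than a half turn, and the last of them starts a square common
  to all. If every gap is at most \<open>l\<close>, a doubly unseparated square is needed.\<close>

lemma common_diagonal:
  assumes p: "p1 \<le> p2" "p2 \<le> p3" "p3 < p1 + 2 * l"
    and z: "0 \<le> z" "2 * z + 1 \<le> l" "l \<le> 2 * z + 2"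
  shows "\<exists>s. antidiagonal l z p1 s \<and> antidiagonal l z p2 s \<and> antidiagonal l z p3 s \<or>
    main_diagonal l z p1 s \<and> main_diagonal l z p2 s \<and> main_diagonal l z p3 s"
proof -
  consider "p3 < p1 + l" | "p2 > p1 + l" | "p3 > p2 + l" "p2 \<le> p1 + l"
    | "p3 \<ge> p1 + l" "p2 \<le> p1 + l" "p3 \<le> p2 + l"
    by linarith
  then show ?thesis
  proof cases
    case 1
    then have "antidiagonal l z p1 p3" "antidiagonal l z p2 p3" "antidiagonal l z p3 p3"
      using p by (auto intro!: antidiagonalI(1))
    then show ?thesis by blast
  next
    case 2
    let ?s = "p1 + 2 * l"
    have "antidiagonal l z p1 ?s" using p 2 by (intro antidiagonalI(2)) auto
    moreover have "antidiagonal l z p2 ?s" "antidiagonal l z p3 ?s"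
      using p 2 by (auto intro!: antidiagonalI(1))
    ultimately show ?thesis by blast
  next
    case 3
    let ?s = "p2 + 2 * l"
    have "antidiagonal l z p1 ?s" "antidiagonal l z p2 ?s"
      using p 3 z by (auto intro!: antidiagonalI(2))
    moreover have "antidiagonal l z p3 ?s"
      using p 3 by (auto intro!: antidiagonalI(1))
    ultimately show ?thesis by blast
  next
    case 4
    let ?a = "p2 - p1" and ?b = "p3 - p2" and ?c = "p1 + 2 * l - p3"
    have gaps: "?a + ?b + ?c = 2 * l" by simp
    \<comment> \<open>Two gaps exceed \<open>z\<close>, since otherwise the third would exceed
      \<open>l\<close>; the largest is at least \<open>l - z\<close> because
      \<open>3 * (l - z - 1) < 2 * l\<close>. Each alternative concerns the two gaps meeting at one
      landmark, whose isolated square then serves.\<close>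
    consider "?a > z" "?c \<ge> l - z" | "?a \<ge> l - z" "?c > z"
      | "?b > z" "?a \<ge> l - z" | "?b \<ge> l - z" "?a > z"
      | "?c > z" "?b \<ge> l - z" | "?c \<ge> l - z" "?b > z"
      using gaps z 4 by linarith
    then show ?thesis
    proof cases
      case 1
      let ?s = "p1 + z"
      have "main_diagonal l z p1 ?s" by (intro main_diagonalI(4)) simp
      moreover have "main_diagonal l z p2 ?s" "main_diagonal l z p3 ?s"
        using 1 4 z by (auto intro!: main_diagonalI(3))
      ultimately show ?thesis by blast
    next
      case 2
      let ?s = "p1 - 1 - z"
      have "antidiagonal l z p1 ?s" by (intro antidiagonalI(4)) simp
      moreover have "antidiagonal l z p2 ?s" "antidiagonal l z p3 ?s"
        using 2 4 z by (auto intro!: antidiagonalI(3))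
      ultimately show ?thesis by blast
    next
      case 3
      let ?s = "p2 + z"
      have "main_diagonal l z p2 ?s" by (intro main_diagonalI(4)) simp
      moreover have "main_diagonal l z p3 ?s"
        using 3 4 z by (auto intro!: main_diagonalI(3))
      moreover have "main_diagonal l z p1 ?s"
        using 3 4 z by (auto intro!: main_diagonalI(1))
      ultimately show ?thesis by blast
    next
      case prems: 4
      let ?s = "p2 - 1 - z"
      have "antidiagonal l z p2 ?s" by (intro antidiagonalI(4)) simp
      moreover have "antidiagonal l z p3 ?s"
        using prems 4 \<open>p3 \<le> p2 + l\<close> z by (auto intro!: antidiagonalI(3))
      moreover have "antidiagonal l z p1 ?s"
        using prems \<open>p2 \<le> p1 + l\<close> z by (auto intro!: antidiagonalI(1))
      ultimately show ?thesis by blast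
    next
      case 5
      let ?s = "p3 + z"
      have "main_diagonal l z p3 ?s" by (intro main_diagonalI(4)) simp
      moreover have "main_diagonal l z p1 ?s" "main_diagonal l z p2 ?s"
        using 5 4 z by (auto intro!: main_diagonalI(1))
      ultimately show ?thesis by blast
    next
      case 6
      let ?s = "p3 - 1 - z"
      have "antidiagonal l z p3 ?s" by (intro antidiagonalI(4)) simp
      moreover have "antidiagonal l z p1 ?s" "antidiagonal l z p2 ?s"
        using 6 4 z by (auto intro!: antidiagonalI(1))
      ultimately show ?thesis by blast
    qed
  qed
qed

text \<open>The third landmark models a vertex on the middle line: in each period \<open>l\<close>
  it fails on the antidiagonal for \<open>e\<close> squares, then on the main diagonal for
  \<open>e\<close> squares. The last alternative is the one configuration left to another
  argument.\<close>

lemma common_diagonal_period: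
  assumes p: "p1 \<le> p2" "p2 < p1 + 2 * l" and e: "l = 2 * e" "z = e - 1" "e > 0"
  shows "(\<exists>s k. antidiagonal l z p1 s \<and> antidiagonal l z p2 s \<and>
      p3 + l * k \<le> s \<and> s < p3 + l * k + e) \<or>
    (\<exists>s k. main_diagonal l z p1 s \<and> main_diagonal l z p2 s \<and>
      p3 + l * k + e \<le> s \<and> s < p3 + l * k + l) \<or>
    (\<exists>k. p2 = p1 + l \<and> p3 = p1 + l * k)"
proof -
  have split: "\<exists>k. p3 + l * k \<le> s \<and> s < p3 + l * k + l" for s
  proof -
    have "l > 0" using e by simp
    then have "0 \<le> (s - p3) mod l" "(s - p3) mod l < l" by simp_all
    then show ?thesis
      by (intro exI[of _ "(s - p3) div l"]) (simp add: minus_div_mult_eq_mod[symmetric] algebra_simps)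
  qed
  \<comment> \<open>A half turn later the first two landmarks fail on the other diagonal, but the third, having
    period \<open>l\<close>, on the same one.\<close>
  have opposite: ?thesis if anti: "antidiagonal l z p1 s" "antidiagonal l z p2 s"
    and main: "main_diagonal l z p1 (s + l)" "main_diagonal l z p2 (s + l)" for s
  proof -
    obtain k where k: "p3 + l * k \<le> s" "s < p3 + l * k + l"
      using split by blast
    show ?thesis
    proof (cases "s < p3 + l * k + e")
      case True
      with anti k show ?thesis by blast
    next
      case False
      then have "p3 + l * (k + 1) + e \<le> s + l" "s + l < p3 + l * (k + 1) + l"
        using k by (simp_all add: algebra_simps)
      with main show ?thesis by blast
    qed
  qed
  consider "p2 < p1 + l" | "p2 > p1 + l" | "p2 = p1 + l" by linarith
  then show ?thesis
  proof cases
    case 1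
    then show ?thesis
      using p e by (intro opposite[of p2] antidiagonalI(1) main_diagonalI(1)) auto
  next
    case 2
    show ?thesis
    proof (rule opposite)
      show "antidiagonal l z p1 (p1 + 2 * l)"
        using e by (intro antidiagonalI(2)) auto
      show "antidiagonal l z p2 (p1 + 2 * l)"
        using 2 p by (intro antidiagonalI(1)) auto
      show "main_diagonal l z p1 (p1 + 2 * l + l)"
        using e by (intro main_diagonalI(2)) auto
      show "main_diagonal l z p2 (p1 + 2 * l + l)"
        using 2 p by (intro main_diagonalI(1)) auto
    qed
  next
    \<comment> \<open>Opposite landmarks share the main diagonal at \<open>p1 + e - 1\<close> and
      the antidiagonal at \<open>p1 + e\<close>. A third landmark congruent to \<open>p1\<close>
      modulo \<open>l\<close> changes from antidiagonal to main diagonal exactly between these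
      squares, so it misses both.\<close>
    case 3
    obtain k where k: "p3 + l * k \<le> p1" "p1 < p3 + l * k + l"
      using split by blast
    consider "p3 + l * k = p1" | "p1 - e \<le> p3 + l * k" "p3 + l * k < p1" | "p3 + l * k < p1 - e"
      using k by linarith
    then show ?thesis
    proof cases
      case 1
      then have "p3 = p1 + l * (- k)" by simp
      with 3 show ?thesis by blast
    next
      case 2
      then have "p3 + l * k + e \<le> p1 + z" "p1 + z < p3 + l * k + l"
        using e by auto
      moreover have "main_diagonal l z p1 (p1 + z)"
        by (intro main_diagonalI(4)) simp
      moreover have "main_diagonal l z p2 (p1 + z)"
        using 3 e by (intro main_diagonalI(3)) auto
      ultimately show ?thesis by blast
    next
      case prems: 3
      then have "p3 + l * (k + 1) \<le> p1 + e" "p1 + e < p3 + l * (k + 1) + e"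
        using e k by (simp_all add: algebra_simps)
      moreover have "antidiagonal l z p1 (p1 + e)"
        using e by (intro antidiagonalI(1)) auto
      moreover have "antidiagonal l z p2 (p1 + e)"
        using 3 e by (intro antidiagonalI(4)) auto
      ultimately show ?thesis by blast
    qed
  qed
qed

text \<open>Pads short lists, so that only triples (possibly with repetitions) have to be treated;
  \<open>d\<close> enters only for the empty list.\<close>

lemma set_subset_triple:
  assumes "length xs \<le> 3"
  shows "\<exists>a b c. set xs \<subseteq> {a, b, c} \<and> {a, b, c} \<subseteq> insert d (set xs)"
proof -
  consider "xs = []" | a where "xs = [a]" | a b where "xs = [a, b]" | a b c where "xs = [a, b, c]"
    using assms by (cases xs; cases "tl xs"; cases "tl (tl xs)"; cases "tl (tl (tl xs))") auto
  then show ?thesis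
  proof cases
    case 1 then show ?thesis by (intro exI[of _ d]) simp
  next
    case (2 a) then show ?thesis by (intro exI[of _ a]) simp
  next
    case (3 a b) then show ?thesis by (intro exI[of _ a] exI[of _ b]) simp
  next
    case (4 a b c) then show ?thesis by (intro exI[of _ a] exI[of _ b] exI[of _ c]) simp
  qed
qed

section \<open>The distance formula\<close>

locale moebius =
  fixes m n :: nat
  assumes n2: "n \<ge> 2" and mn: "m \<ge> n + 4" and parity: "even m \<longleftrightarrow> even n"
begin

abbreviation G where "G \<equiv> with_proj (moebius_ladder m n)"
abbreviation L where "L \<equiv> int m - 1"
abbreviation N where "N \<equiv> int n"

sublocale pair_graph "moebius_ladder m n"
  using mn by (intro pair_graph_moebius_ladder) simp

lemma verts_G: "(i, j) \<in> pverts (moebius_ladder m n) \<longleftrightarrow> 1 \<le> i \<and> i \<le> m - 1 \<and> 1 \<le> j \<and> j \<le> n"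
  by (auto simp: moebius_ladder_def)

lemma arcs_G: "parcs (moebius_ladder m n) = moebius_edges m n \<union> (moebius_edges m n)\<inverse>"
  by (simp add: moebius_ladder_def)

definition mdist :: "nat \<times> nat \<Rightarrow> nat \<times> nat \<Rightarrow> int" where
  "mdist v w =
     (let a = \<bar>int (fst v) - int (fst w)\<bar> in
      min (a + \<bar>int (snd v) - int (snd w)\<bar>) (L - a + \<bar>int (snd v) + int (snd w) - (N + 1)\<bar>))"

lemma min_diff_le:
  fixes a b c d e :: int
  assumes "\<bar>a - c\<bar> \<le> e" "\<bar>b - d\<bar> \<le> e"
  shows "\<bar>min a b - min c d\<bar> \<le> e"
  using assms by linarith

text \<open>Within a column or a row each argument of \<open>min\<close> changes by at most one.
  Across the seam the two arguments also exchange their roles.\<close>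

lemma mdist_edge:
  assumes "(u, v) \<in> moebius_edges m n" "w \<in> verts G"
  shows "\<bar>mdist u w - mdist v w\<bar> \<le> 1"
proof -
  obtain i j k l i' j' where uvw: "u = (i, j)" "v = (k, l)" "w = (i', j')"
    by (metis surj_pair)
  with assms(2) have R: "1 \<le> i'" "i' \<le> m - 1" "1 \<le> j'" "j' \<le> n"
    by (simp_all add: verts_G)
  consider "k = i" "l = j + 1" | "k = i + 1" "l = j"
    | "1 \<le> j" "j \<le> n" "i = m - 1" "k = 1" "l = n + 1 - j"
    using assms(1) uvw by (auto simp: moebius_edges_def)
  then show ?thesis
  proof cases
    case 1
    then show ?thesis unfolding mdist_def Let_def uvw fst_conv snd_conv
      by (intro min_diff_le) auto
  next
    case 2
    then show ?thesis unfolding mdist_def Let_def uvw fst_conv snd_conv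
      by (intro min_diff_le) auto
  next
    case 3
    then have l: "int l = N + 1 - int j" and "int i = L" "int k = 1"
      using mn by auto
    with R have "\<bar>int i - int i'\<bar> = L - int i'" "\<bar>int k - int i'\<bar> = int i' - 1"
      by auto
    moreover have "\<bar>int l + int j' - (N + 1)\<bar> = \<bar>int j - int j'\<bar>"
      "\<bar>int l - int j'\<bar> = \<bar>int j + int j' - (N + 1)\<bar>"
      unfolding l by linarith+
    ultimately show ?thesis
      unfolding mdist_def Let_def uvw fst_conv snd_conv
      by (simp only:, subst min.commute, intro min_diff_le) auto
  qed
qed

lemma mdist_arc:
  assumes "u \<rightarrow>\<^bsub>G\<^esub> v" "w \<in> verts G"
  shows "mdist u w \<le> mdist v w + 1"
  using assms mdist_edge[of u v w] mdist_edge[of v u w] by (auto simp: arcs_G)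

lemma mdist_refl: "mdist v v = 0"
  using mn by (simp add: mdist_def)

lemma mdist_le_walk:
  assumes "awalk u p v"
  shows "mdist u v \<le> int (length p)"
  using assms
proof (induct p arbitrary: u)
  case Nil
  then show ?case by (auto simp: awalk_def mdist_refl)
next
  case (Cons e p)
  then have e: "e \<in> arcs G" "fst e = u" and p: "awalk (snd e) p v"
    by (auto simp: awalk_Cons_iff)
  moreover have "v \<in> verts G"
    using p by auto
  ultimately have "mdist u v \<le> mdist (snd e) v + 1"
    by (intro mdist_arc) (auto simp: arcs_G)
  with Cons(1)[OF p] show ?case by simp
qed

lemma mdist_descent:
  assumes "v \<in> verts G" "w \<in> verts G" "mdist v w > 0"
  shows "\<exists>u. v \<rightarrow>\<^bsub>G\<^esub> u \<and> mdist u w < mdist v w"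
proof -
  obtain i j k l where vw: "v = (i, j)" "w = (k, l)"
    by (metis surj_pair)
  have R: "1 \<le> i" "i \<le> m - 1" "1 \<le> j" "j \<le> n" "1 \<le> k" "k \<le> m - 1" "1 \<le> l" "l \<le> n"
    using assms(1,2) vw by (simp_all add: verts_G)
  have up: "v \<rightarrow>\<^bsub>G\<^esub> (i, j + 1)" if "j < n"
    using that R vw by (auto simp: arcs_G moebius_edges_def)
  have down: "v \<rightarrow>\<^bsub>G\<^esub> (i, j - 1)" if "j > 1"
    using that R vw by (auto simp: arcs_G moebius_edges_def)
  have right: "v \<rightarrow>\<^bsub>G\<^esub> (i + 1, j)" if "i < m - 1"
    using that R vw by (auto simp: arcs_G moebius_edges_def)
  have left: "v \<rightarrow>\<^bsub>G\<^esub> (i - 1, j)" if "i > 1"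
    using that R vw by (auto simp: arcs_G moebius_edges_def)
  have right_seam: "v \<rightarrow>\<^bsub>G\<^esub> (1, n + 1 - j)" if "i = m - 1"
    using that R vw by (auto simp: arcs_G moebius_edges_def)
  have left_seam: "v \<rightarrow>\<^bsub>G\<^esub> (m - 1, n + 1 - j)" if "i = 1"
  proof -
    have "((m - 1, n + 1 - j), (1, n + 1 - (n + 1 - j))) \<in> moebius_edges m n"
      using R unfolding moebius_edges_def by fastforce
    then show ?thesis using that R vw by (auto simp: arcs_G)
  qed
  let ?a = "\<bar>int i - int k\<bar>"
  show ?thesis
  proof (cases "?a + \<bar>int j - int l\<bar> \<le> L - ?a + \<bar>int j + int l - (N + 1)\<bar>")
    case True
    then have eq: "mdist v w = ?a + \<bar>int j - int l\<bar>"
      by (simp add: vw mdist_def Let_def)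
    with assms(3) have ne: "i \<noteq> k \<or> j \<noteq> l" by auto
    have *: "mdist u w < mdist v w"
      if "\<bar>int (fst u) - int k\<bar> + \<bar>int (snd u) - int l\<bar> < ?a + \<bar>int j - int l\<bar>" for u
      unfolding eq using that by (simp add: vw mdist_def Let_def min_less_iff_disj)
    consider "j < l" | "j > l" | "i < k" | "i > k"
      using ne by linarith
    then show ?thesis
    proof cases
      case 1 then show ?thesis using R by (intro exI[of _ "(i, j + 1)"] conjI up *) auto
    next
      case 2 then show ?thesis using R by (intro exI[of _ "(i, j - 1)"] conjI down *) auto
    next
      case 3 then show ?thesis using R by (intro exI[of _ "(i + 1, j)"] conjI right *) auto
    next
      case 4 then show ?thesis using R by (intro exI[of _ "(i - 1, j)"] conjI left *) auto
    qed
  next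
    case False
    then have eq: "mdist v w = L - ?a + \<bar>int j + int l - (N + 1)\<bar>"
      by (simp add: vw mdist_def Let_def)
    have *: "mdist u w < mdist v w"
      if "L - \<bar>int (fst u) - int k\<bar> + \<bar>int (snd u) + int l - (N + 1)\<bar>
            < L - ?a + \<bar>int j + int l - (N + 1)\<bar>" for u
      unfolding eq using that by (simp add: vw mdist_def Let_def min_less_iff_disj)
    \<comment> \<open>Used when the step crosses the seam: the direct distance from the new vertex
      then continues the twisted one.\<close>
    have **: "mdist u w < mdist v w"
      if "\<bar>int (fst u) - int k\<bar> + \<bar>int (snd u) - int l\<bar>
            < L - ?a + \<bar>int j + int l - (N + 1)\<bar>" for u
      unfolding eq using that by (simp add: vw mdist_def Let_def min_less_iff_disj)
    \<comment> \<open>In a common column the direct distance is at most \<open>n - 1\<close>, which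
      is less than \<open>L\<close>.\<close>
    have "i \<noteq> k"
      using False R mn by auto
    then consider "j + l < n + 1" | "j + l > n + 1" | "j + l = n + 1" "i < k" "i > 1"
      | "j + l = n + 1" "i < k" "i = 1" | "j + l = n + 1" "i > k" "i < m - 1"
      | "j + l = n + 1" "i > k" "i = m - 1"
      using R by linarith
    then show ?thesis
    proof cases
      case 1 then show ?thesis using R by (intro exI[of _ "(i, j + 1)"] conjI up *) auto
    next
      case 2 then show ?thesis using R by (intro exI[of _ "(i, j - 1)"] conjI down *) auto
    next
      case 3 then show ?thesis using R by (intro exI[of _ "(i - 1, j)"] conjI left *) auto
    next
      case 4 then show ?thesis using R mn by (intro exI[of _ "(m - 1, n + 1 - j)"] conjI left_seam **) auto
    next
      case 5 then show ?thesis using R by (intro exI[of _ "(i + 1, j)"] conjI right *) auto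
    next
      case 6 then show ?thesis using R mn by (intro exI[of _ "(1, n + 1 - j)"] conjI right_seam **) auto
    qed
  qed
qed

lemma mdist_eq_0:
  assumes "v \<in> verts G" "w \<in> verts G" "mdist v w \<le> 0"
  shows "v = w"
proof -
  obtain i j k l where vw: "v = (i, j)" "w = (k, l)"
    by (metis surj_pair)
  then show ?thesis
    using assms mn unfolding vw mdist_def Let_def fst_conv snd_conv
    by (auto simp: verts_G min_le_iff_disj)
qed

lemma walk_of_mdist:
  assumes "v \<in> verts G" "w \<in> verts G"
  shows "\<exists>p. awalk v p w \<and> int (length p) \<le> mdist v w"
  using assms
proof (induct "nat (mdist v w)" arbitrary: v rule: less_induct)
  case less
  show ?case
  proof (cases "mdist v w > 0")
    case True
    then obtain u where u: "v \<rightarrow>\<^bsub>G\<^esub> u" "mdist u w < mdist v w"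
      using mdist_descent less(2,3) by blast
    moreover from u(1) have "u \<in> verts G"
      by (auto dest: in_arcsD2)
    ultimately obtain p where "awalk u p w" "int (length p) \<le> mdist u w"
      using less(1)[of u] less(3) True by auto
    with u show ?thesis
      by (intro exI[of _ "(v, u) # p"]) (auto simp: awalk_Cons_iff)
  next
    case False
    then have "v = w" using mdist_eq_0 less(2,3) by simp
    then show ?thesis using less(2)
      by (intro exI[of _ "[]"]) (auto simp: awalk_def mdist_refl)
  qed
qed

text \<open>No arc lowers \<open>mdist\<close> by more than one, and repeated descent gives a walk
  attaining it. Passing to the infimum \<mu> over walks avoids having to shorten that walk to a
  path.\<close>

lemma graph_dist_eq_mdist:
  assumes "v \<in> verts G" "w \<in> verts G"
  shows "int (graph_dist G v w) = mdist v w"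
proof -
  have cost: "awalk_cost (\<lambda>_. 1) p = real (length p)" for p :: "((nat \<times> nat) \<times> nat \<times> nat) list"
    by (induct p) auto
  obtain p where p: "awalk v p w" "int (length p) \<le> mdist v w"
    using walk_of_mdist[OF assms] by blast
  then have len: "int (length p) = mdist v w"
    using mdist_le_walk by (simp add: order.antisym)
  have "\<mu> (\<lambda>_. 1) v w = ereal (real (length p))"
    unfolding \<mu>_def cost
  proof (rule INF_eqI)
    show "ereal (real (length p)) \<le> ereal (real (length q))" if "q \<in> {q. awalk v q w}" for q
      using mdist_le_walk[of v q w] that len by simp
    show "y \<le> ereal (real (length p))"
      if "\<And>q. q \<in> {q. awalk v q w} \<Longrightarrow> y \<le> ereal (real (length q))" for y
      using that[of p] p by simp
  qed
  moreover have "v \<rightarrow>\<^sup>*\<^bsub>G\<^esub> w"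
    using p(1) by (auto simp: reachable_awalk)
  ultimately have "graph_dist G v w = length p"
    using graph_dist_eq_mu by fastforce
  then show ?thesis using len by simp
qed

section \<open>Coordinates on the unrolled strip\<close>

text \<open>The covering map from the strip: odd turns are reflected, and strip column 0 is column 1
  of the graph.\<close>

definition point :: "int \<Rightarrow> int \<Rightarrow> nat \<times> nat" where
  "point x y = (nat (x mod L) + 1, nat (if even (x div L) then y else N + 1 - y))"

lemma point_in_verts: "1 \<le> y \<Longrightarrow> y \<le> N \<Longrightarrow> point x y \<in> verts G"
proof -
  assume "1 \<le> y" "y \<le> N"
  moreover have "0 \<le> x mod L" "x mod L < L"
    using mn by simp_all
  ultimately show ?thesis by (auto simp: point_def verts_G nat_le_iff nat_less_iff)
qed

lemma point_shift: "point (x + L) y = point x (N + 1 - y)"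
  using mn by (simp add: point_def)

lemma point_shift2: "point (x + 2 * L * k) y = point x y"
proof -
  have "x + 2 * L * k = x + (2 * k) * L" by simp
  moreover have "(x + (2 * k) * L) mod L = x mod L" "(x + (2 * k) * L) div L = x div L + 2 * k"
    using mn by (simp_all only: mod_mult_self1 div_mult_self1)
  ultimately show ?thesis by (simp only: point_def) simp
qed

lemma vertex_eq_point:
  assumes "(i, j) \<in> verts G"
  shows "(i, j) = point (int i - 1) (int j)"
proof -
  have "0 \<le> int i - 1" "int i - 1 < L"
    using assms mn by (auto simp: verts_G)
  then show ?thesis
    using assms by (auto simp: verts_G point_def)
qed

lemma mdist_sym: "mdist v w = mdist w v"
  by (simp add: mdist_def Let_def abs_minus_commute add.commute)

text \<open>Lifts at most \<open>L\<close> columns apart lie in the same turn or in consecutive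
  ones. In the second case reducing to one turn replaces the column difference by its complement to
  \<open>L\<close> and reflects one row, which swaps the arguments of \<open>min\<close>.\<close>

lemma mdist_point_aux:
  assumes y: "1 \<le> y" "y \<le> N" and h: "1 \<le> h" "h \<le> N" and xp: "p \<le> x" "x - p \<le> L"
  shows "mdist (point x y) (point p h) = min (x - p + \<bar>y - h\<bar>) (L - (x - p) + \<bar>y + h - (N + 1)\<bar>)"
proof -
  have L: "L > 0" using mn by simp
  define k l a b where "k = x div L" "l = p div L" "a = x mod L" "b = p mod L"
  have x: "x = k * L + a" "p = l * L + b" and ab: "0 \<le> a" "a < L" "0 \<le> b" "b < L"
    using L unfolding k_l_a_b_def by (simp_all only: div_mult_mod_eq pos_mod_sign pos_mod_bound)
  have md: "mdist (point x y) (point p h) =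
    (let Y = if even k then y else N + 1 - y; H = if even l then h else N + 1 - h in
     min (\<bar>a - b\<bar> + \<bar>Y - H\<bar>) (L - \<bar>a - b\<bar> + \<bar>Y + H - (N + 1)\<bar>))"
  proof -
    have "int (snd (point x y)) = (if even k then y else N + 1 - y)"
      "int (snd (point p h)) = (if even l then h else N + 1 - h)"
      "\<bar>int (fst (point x y)) - int (fst (point p h))\<bar> = \<bar>a - b\<bar>"
      using y h ab unfolding point_def k_l_a_b_def[symmetric] by simp_all
    then show ?thesis
      unfolding mdist_def Let_def by (simp only:)
  qed
  have "l \<le> k" using xp(1) L unfolding k_l_a_b_def by (intro zdiv_mono1)
  moreover have "k \<le> l + 1"
  proof -
    have "x div L \<le> (p + L) div L" using xp L by (intro zdiv_mono1) auto
    also have "\<dots> = l + 1" using L by (simp add: k_l_a_b_def)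
    finally show ?thesis by (simp add: k_l_a_b_def)
  qed
  ultimately consider "k = l" | "k = l + 1" by linarith
  then show ?thesis
  proof cases
    case 1
    then have "x - p = a - b" using x by simp
    with xp have "\<bar>a - b\<bar> = x - p" by simp
    moreover have "\<bar>N + 1 - y - (N + 1 - h)\<bar> = \<bar>y - h\<bar>"
      "\<bar>N + 1 - y + (N + 1 - h) - (N + 1)\<bar> = \<bar>y + h - (N + 1)\<bar>"
      by linarith+
    ultimately show ?thesis
      unfolding md Let_def
      by (cases "even l") (simp_all only: 1 if_True if_False)
  next
    case 2
    then have "x - p = L + a - b" using x by (simp add: algebra_simps)
    with xp have "\<bar>a - b\<bar> = L - (x - p)" by simp
    moreover have "L - (L - (x - p)) = x - p" by simp
    moreover have "\<bar>N + 1 - y - h\<bar> = \<bar>y + h - (N + 1)\<bar>" "\<bar>y - (N + 1 - h)\<bar> = \<bar>y + h - (N + 1)\<bar>"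
      "\<bar>N + 1 - y + h - (N + 1)\<bar> = \<bar>y - h\<bar>" "\<bar>y + (N + 1 - h) - (N + 1)\<bar> = \<bar>y - h\<bar>"
      by linarith+
    ultimately show ?thesis
      unfolding md Let_def
      by (cases "even l") (simp_all only: 2 even_plus_one_iff not_not if_True if_False not_True_eq_False not_False_eq_True min.commute)
  qed
qed

lemma mdist_point:
  assumes "1 \<le> y" "y \<le> N" "1 \<le> h" "h \<le> N" "\<bar>x - p\<bar> \<le> L"
  shows "mdist (point x y) (point p h) =
    min (\<bar>x - p\<bar> + \<bar>y - h\<bar>) (L - \<bar>x - p\<bar> + \<bar>y + h - (N + 1)\<bar>)"
proof (cases "p \<le> x")
  case True
  with assms show ?thesis by (subst mdist_point_aux) auto
next
  case False
  with assms show ?thesis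
    by (subst mdist_sym, subst mdist_point_aux) (auto simp: abs_if algebra_simps)
qed

lemma point_neq:
  assumes "1 \<le> y" "y \<le> N" "1 \<le> h" "h \<le> N" "\<bar>x - p\<bar> < L" "x \<noteq> p \<or> y \<noteq> h"
  shows "point x y \<noteq> point p h"
proof -
  have "mdist (point x y) (point p h) > 0"
    using assms by (subst mdist_point) auto
  then show ?thesis by (auto simp: mdist_refl)
qed

text \<open>Every vertex has a lift in the lower half of the strip, since \<open>p\<close> ranges over two turns.\<close>

lemma vertex_lift:
  assumes "w \<in> verts G"
  obtains p h where "w = point p h" "1 \<le> h" "2 * h \<le> N + 1" "0 \<le> p" "p < 2 * L"
proof -
  obtain i j where w: "w = (i, j)" by (metis surj_pair)
  with assms have R: "1 \<le> i" "i \<le> m - 1" "1 \<le> j" "j \<le> n"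
    by (simp_all add: verts_G)
  have eq: "w = point (int i - 1) (int j)"
    using vertex_eq_point assms w by simp
  show ?thesis
  proof (cases "2 * int j \<le> N + 1")
    case True
    with eq R show ?thesis by (intro that[of "int i - 1" "int j"]) auto
  next
    case False
    have "w = point (int i - 1 + L) (N + 1 - int j)"
      using eq point_shift[of "int i - 1" "N + 1 - int j"] by simp
    with False R show ?thesis
      by (intro that[of "int i - 1 + L" "N + 1 - int j"]) auto
  qed
qed

text \<open>\<open>y0\<close> is the central row of squares (the upper of the two if \<open>n\<close> is odd).\<close>

definition y0 :: int where "y0 = (N + 1) div 2"
definition z0 :: int where "z0 = (L - 1) div 2"

lemma y0_z0: "2 * z0 + 2 * y0 = L + N - 1" "1 \<le> y0" "y0 < N" "0 \<le> z0" "z0 < L"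
  "2 * z0 + 1 \<le> L" "L \<le> 2 * z0 + 2" "N \<le> 2 * y0" "2 * y0 \<le> N + 1"
proof -
  have "even (L + N - 1)" using parity by simp
  then show "2 * z0 + 2 * y0 = L + N - 1"
    unfolding y0_def z0_def by presburger
  show "1 \<le> y0" "y0 < N" "0 \<le> z0" "z0 < L"
     "2 * z0 + 1 \<le> L" "L \<le> 2 * z0 + 2" "N \<le> 2 * y0" "2 * y0 \<le> N + 1"
    using n2 mn unfolding y0_def z0_def by linarith+
qed

section \<open>Diagonals of central squares that a landmark off the middle line does not
  separate\<close>

text \<open>Since \<open>h \<le> y0\<close> and \<open>y0 + h \<le> N\<close>, all row differences
  have fixed signs, and along the half turn both Manhattan distances are constant on the
  antidiagonal. At the isolated square the twisted distance at one end equals the direct one at the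
  other, both being \<open>z0 + y0 - h\<close>; this is where parity enters.\<close>

lemma antidiagonal_mdist_eq:
  assumes h: "1 \<le> h" "2 * h \<le> N" and s: "antidiagonal L z0 p s"
  shows "mdist (point s (y0 + 1)) (point p h) = mdist (point (s + 1) y0) (point p h)"
proof -
  obtain k where k: "p + 2 * L * k \<le> s \<and> s < p + 2 * L * k + L \<or> s = p + 2 * L * k - 1 - z0"
    using s unfolding antidiagonal_def by blast
  define q where "q = p + 2 * L * k"
  have q: "point p h = point q h"
    by (simp only: q_def point_shift2)
  have yh: "y0 + h \<le> N"
    using h y0_z0 by linarith
  from k[folded q_def] show ?thesis
  proof
    assume "q \<le> s \<and> s < q + L"
    then show ?thesis
      unfolding q using h yh y0_z0 by (subst (1 2) mdist_point) (auto simp: abs_of_nonneg abs_of_nonpos)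
  next
    assume "s = q - 1 - z0"
    then show ?thesis
      unfolding q using h yh y0_z0 by (subst (1 2) mdist_point) (auto simp: abs_of_nonneg abs_of_nonpos)
  qed
qed

lemma main_diagonal_mdist_eq:
  assumes h: "1 \<le> h" "2 * h \<le> N" and s: "main_diagonal L z0 p s"
  shows "mdist (point s y0) (point p h) = mdist (point (s + 1) (y0 + 1)) (point p h)"
proof -
  obtain k where k: "p + 2 * L * k + L \<le> s \<and> s < p + 2 * L * k + 2 * L \<or> s = p + 2 * L * k + z0"
    using s unfolding main_diagonal_def by blast
  define q where "q = p + 2 * L * k"
  have q: "point p h = point q h"
    by (simp only: q_def point_shift2)
  \<comment> \<open>The reflected lift lies above the lower row of the square, so in the second half
    turn the diagonals exchange roles.\<close>
  have q': "point q h = point (q + L) (N + 1 - h)"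
    by (simp add: point_shift)
  have yh: "y0 + h \<le> N"
    using h y0_z0 by linarith
  from k[folded q_def] show ?thesis
  proof
    assume "q + L \<le> s \<and> s < q + 2 * L"
    then show ?thesis
      unfolding q q' using h yh y0_z0 by (subst (1 2) mdist_point) (auto simp: abs_of_nonneg abs_of_nonpos)
  next
    assume "s = q + z0"
    then show ?thesis
      unfolding q using h yh y0_z0 by (subst (1 2) mdist_point) (auto simp: abs_of_nonneg abs_of_nonpos)
  qed
qed

section \<open>No three vertices resolve\<close>

text \<open>A set rather than a list, so that permuted or coinciding landmarks need no separate
  treatment.\<close>

definition unresolved :: "(nat \<times> nat) set \<Rightarrow> bool" where
  "unresolved W \<longleftrightarrow>
     (\<exists>u\<in>verts G. \<exists>v\<in>verts G. u \<noteq> v \<and> (\<forall>w\<in>W. mdist u w = mdist v w))"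

text \<open>The bound 2 allows for diagonals of squares and for the two neighbours of a column;
  being less than \<open>L\<close>, it keeps distinct lifts distinct as vertices.\<close>

lemma unresolved_points:
  assumes "1 \<le> y" "y \<le> N" "1 \<le> h" "h \<le> N" "\<bar>x - p\<bar> \<le> 2" "x \<noteq> p \<or> y \<noteq> h"
    and "\<And>w. w \<in> W \<Longrightarrow> mdist (point x y) w = mdist (point p h) w"
  shows "unresolved W"
proof -
  have "\<bar>x - p\<bar> < L" using assms(5) mn n2 by linarith
  then show ?thesis
    unfolding unresolved_def using assms
    by (intro bexI[of _ "point x y"] bexI[of _ "point p h"] conjI point_neq point_in_verts) auto
qed

lemma unresolved_square:
  assumes "(\<forall>w\<in>W. mdist (point s (y0 + 1)) w = mdist (point (s + 1) y0) w) \<or>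
           (\<forall>w\<in>W. mdist (point s y0) w = mdist (point (s + 1) (y0 + 1)) w)"
  shows "unresolved W"
  using assms
proof
  assume "\<forall>w\<in>W. mdist (point s (y0 + 1)) w = mdist (point (s + 1) y0) w"
  then show ?thesis
    using y0_z0 by (intro unresolved_points[of "y0 + 1" y0 s "s + 1"]) auto
next
  assume "\<forall>w\<in>W. mdist (point s y0) w = mdist (point (s + 1) (y0 + 1)) w"
  then show ?thesis
    using y0_z0 by (intro unresolved_points[of y0 "y0 + 1" s "s + 1"]) auto
qed

lemma unresolved_off_centre:
  assumes "0 \<le> p1" "p1 < 2 * L" "0 \<le> p2" "p2 < 2 * L" "0 \<le> p3" "p3 < 2 * L"
    and h: "1 \<le> h1" "2 * h1 \<le> N" "1 \<le> h2" "2 * h2 \<le> N" "1 \<le> h3" "2 * h3 \<le> N"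
  shows "unresolved {point p1 h1, point p2 h2, point p3 h3}"
proof -
  have sorted: "unresolved {point p1 h1, point p2 h2, point p3 h3}"
    if p: "p1 \<le> p2" "p2 \<le> p3" "p3 < p1 + 2 * L"
      and h: "1 \<le> h1" "2 * h1 \<le> N" "1 \<le> h2" "2 * h2 \<le> N" "1 \<le> h3" "2 * h3 \<le> N"
    for p1 p2 p3 h1 h2 h3
  proof -
    obtain s where s: "antidiagonal L z0 p1 s \<and> antidiagonal L z0 p2 s \<and> antidiagonal L z0 p3 s \<or>
      main_diagonal L z0 p1 s \<and> main_diagonal L z0 p2 s \<and> main_diagonal L z0 p3 s"
      using common_diagonal[OF p y0_z0(4,6,7)] by blast
    show ?thesis
      by (rule unresolved_square[of _ s])
        (use s h antidiagonal_mdist_eq main_diagonal_mdist_eq in auto)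
  qed
  have "p1 \<le> p2 \<and> p2 \<le> p3 \<or> p1 \<le> p3 \<and> p3 \<le> p2 \<or> p2 \<le> p1 \<and> p1 \<le> p3 \<or>
    p2 \<le> p3 \<and> p3 \<le> p1 \<or> p3 \<le> p1 \<and> p1 \<le> p2 \<or> p3 \<le> p2 \<and> p2 \<le> p1"
    by linarith
  then show ?thesis
    using sorted[of p1 p2 p3 h1 h2 h3] sorted[of p1 p3 p2 h1 h3 h2] sorted[of p2 p1 p3 h2 h1 h3]
      sorted[of p2 p3 p1 h2 h3 h1] sorted[of p3 p1 p2 h3 h1 h2] sorted[of p3 p2 p1 h3 h2 h1] assms
    by (auto simp: insert_commute)
qed

lemma centre_shift: "point (p + L * k) h = point p h" if "2 * h = N + 1"
proof -
  have "N + 1 - h = h" using that by simp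
  moreover have "(p + L * k) mod L = p mod L" by simp
  ultimately show ?thesis by (simp only: point_def if_cancel)
qed

text \<open>Up to half a band length from the landmark the direct distance is the minimum at both
  ends; in the main diagonal counterpart below, the twisted one is.\<close>

lemma centre_antidiagonal_mdist_eq:
  assumes N: "2 * y0 = N + 1" "L = 2 * e" and s: "p + L * k \<le> s" "s < p + L * k + e"
  shows "mdist (point s (y0 + 1)) (point p y0) = mdist (point (s + 1) y0) (point p y0)"
proof -
  define q where "q = p + L * k"
  have q: "point p y0 = point q y0"
    by (simp only: q_def centre_shift[OF N(1)])
  show ?thesis
    unfolding q using N y0_z0 s[folded q_def] by (subst (1 2) mdist_point) (auto simp: abs_if)
qed

lemma centre_main_diagonal_mdist_eq:
  assumes N: "2 * y0 = N + 1" "L = 2 * e" and s: "p + L * k + e \<le> s" "s < p + L * k + L"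
  shows "mdist (point s y0) (point p y0) = mdist (point (s + 1) (y0 + 1)) (point p y0)"
proof -
  define q where "q = p + L * k"
  have q: "point p y0 = point q y0"
    by (simp only: q_def centre_shift[OF N(1)])
  show ?thesis
    unfolding q using N y0_z0 s[folded q_def] by (subst (1 2) mdist_point) (auto simp: abs_if)
qed

text \<open>Reflection in the middle line preserves distances and fixes the landmark.\<close>

lemma centre_vertical_mdist_eq:
  assumes N: "2 * y0 = N + 1"
  shows "mdist (point x (y0 + 1)) (point p y0) = mdist (point x (y0 - 1)) (point p y0)"
proof -
  define q where "q = p + L * ((x - p) div L)"
  have q: "point p y0 = point q y0"
    by (simp only: q_def centre_shift[OF N(1)])
  have "x - q = (x - p) mod L"
    unfolding q_def by (simp add: minus_div_mult_eq_mod[symmetric] algebra_simps)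
  then have "0 \<le> x - q" "x - q < L" using mn by simp_all
  then show ?thesis
    unfolding q using N n2 y0_z0 by (subst (1 2) mdist_point) (auto simp: abs_if)
qed

lemma horizontal_mdist_eq:
  assumes "1 \<le> y" "y \<le> N" "1 \<le> h" "h \<le> N"
  shows "mdist (point (x - 1) y) (point x h) = mdist (point (x + 1) y) (point x h)"
  using assms mn by (subst (1 2) mdist_point) auto

lemma unresolved_two_centres:
  assumes N: "2 * y0 = N + 1" and h: "1 \<le> h" "2 * h \<le> N + 1"
  shows "unresolved {point p h, point q y0, point r y0}"
proof -
  \<comment> \<open>Here both routes cover \<open>L div 2\<close> columns, so exchanging the rows
    \<open>y0 + 1\<close> and \<open>y0 - 1\<close> merely swaps the arguments of
    \<open>min\<close>.\<close>
  define x where "x = p + L div 2"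
  have "even L" using N parity by presburger
  then have "mdist (point x (y0 + 1)) (point p h) = mdist (point x (y0 - 1)) (point p h)"
    if "2 * h \<le> N"
  proof -
    have "h < y0" using that N by linarith
    then show ?thesis
      using N h n2 mn y0_z0 \<open>even L\<close> unfolding x_def
      by (subst (1 2) mdist_point) (auto simp: abs_of_nonneg abs_of_nonpos)
  qed
  moreover have "h = y0" if "\<not> 2 * h \<le> N"
    using that N h by simp
  ultimately have "mdist (point x (y0 + 1)) (point p h) = mdist (point x (y0 - 1)) (point p h)"
    using centre_vertical_mdist_eq[OF N] by blast
  then show ?thesis
    using N n2 y0_z0 centre_vertical_mdist_eq[OF N]
    by (intro unresolved_points[of "y0 + 1" "y0 - 1" x x]) auto
qed

lemma unresolved_one_centre:
  assumes N: "2 * y0 = N + 1" and h: "1 \<le> h1" "2 * h1 \<le> N" "1 \<le> h2" "2 * h2 \<le> N"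
    and p: "0 \<le> p1" "p1 < 2 * L" "0 \<le> p2" "p2 < 2 * L"
  shows "unresolved {point p1 h1, point p2 h2, point p3 y0}"
proof -
  have sorted: "unresolved {point p1 h1, point p2 h2, point p3 y0}"
    if p: "p1 \<le> p2" "p2 < p1 + 2 * L" and h: "1 \<le> h1" "2 * h1 \<le> N" "1 \<le> h2" "2 * h2 \<le> N"
    for p1 p2 h1 h2
  proof -
    define e where "e = L div 2"
    have "even L" using N parity by presburger
    then have e: "L = 2 * e" "z0 = e - 1" "e > 0"
      using mn y0_z0 N unfolding e_def by auto
    consider s k where "antidiagonal L z0 p1 s" "antidiagonal L z0 p2 s"
        "p3 + L * k \<le> s" "s < p3 + L * k + e"
      | s k where "main_diagonal L z0 p1 s" "main_diagonal L z0 p2 s"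
        "p3 + L * k + e \<le> s" "s < p3 + L * k + L"
      | k where "p2 = p1 + L" "p3 = p1 + L * k"
      using common_diagonal_period[OF p e] by blast
    then show ?thesis
    proof cases
      case (1 s k)
      show ?thesis
        by (rule unresolved_square[of _ s])
          (use 1 h antidiagonal_mdist_eq centre_antidiagonal_mdist_eq[OF N e(1)] in auto)
    next
      case (2 s k)
      show ?thesis
        by (rule unresolved_square[of _ s])
          (use 2 h main_diagonal_mdist_eq centre_main_diagonal_mdist_eq[OF N e(1)] in auto)
    next
      case (3 k)
      \<comment> \<open>All three landmarks now have a lift in column \<open>p1\<close>, so its left
        and right neighbours in the middle row are equidistant from each.\<close>
      then have "point p2 h2 = point p1 (N + 1 - h2)" "point p3 y0 = point p1 y0"
        by (simp_all only: point_shift centre_shift[OF N])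
      then show ?thesis
        using h y0_z0 horizontal_mdist_eq[of y0]
        by (intro unresolved_points[of y0 y0 "p1 - 1" "p1 + 1"]) auto
    qed
  qed
  show ?thesis
    using sorted[of p1 p2 h1 h2] sorted[of p2 p1 h2 h1] p h
    by (cases "p1 \<le> p2") (auto simp: insert_commute)
qed

lemma unresolved_triple:
  assumes "w1 \<in> verts G" "w2 \<in> verts G" "w3 \<in> verts G"
  shows "unresolved {w1, w2, w3}"
proof -
  obtain p1 h1 where 1: "w1 = point p1 h1" "1 \<le> h1" "2 * h1 \<le> N + 1" "0 \<le> p1" "p1 < 2 * L"
    by (rule vertex_lift[OF assms(1)])
  obtain p2 h2 where 2: "w2 = point p2 h2" "1 \<le> h2" "2 * h2 \<le> N + 1" "0 \<le> p2" "p2 < 2 * L"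
    by (rule vertex_lift[OF assms(2)])
  obtain p3 h3 where 3: "w3 = point p3 h3" "1 \<le> h3" "2 * h3 \<le> N + 1" "0 \<le> p3" "p3 < 2 * L"
    by (rule vertex_lift[OF assms(3)])
  have centre: "2 * h \<le> N \<or> h = y0 \<and> 2 * y0 = N + 1" if "2 * h \<le> N + 1" for h
    using that y0_z0(8,9) by presburger
  show ?thesis
    using centre[OF 1(3)] centre[OF 2(3)] centre[OF 3(3)]
  proof (elim disjE)
    assume "2 * h1 \<le> N" "2 * h2 \<le> N" "2 * h3 \<le> N"
    then show ?thesis
      using 1 2 3 unresolved_off_centre by simp
  next
    assume "2 * h1 \<le> N" "2 * h2 \<le> N" "h3 = y0 \<and> 2 * y0 = N + 1"
    then show ?thesis
      using 1 2 3 unresolved_one_centre by simp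
  next
    assume "2 * h1 \<le> N" "h2 = y0 \<and> 2 * y0 = N + 1" "2 * h3 \<le> N"
    then show ?thesis
      using 1 2 3 unresolved_one_centre[of h1 h3 p1 p3 p2] by (simp add: insert_commute)
  next
    assume "h1 = y0 \<and> 2 * y0 = N + 1" "2 * h2 \<le> N" "2 * h3 \<le> N"
    then show ?thesis
      using 1 2 3 unresolved_one_centre[of h2 h3 p2 p3 p1] by (simp add: insert_commute)
  next
    assume "2 * h1 \<le> N" "h2 = y0 \<and> 2 * y0 = N + 1" "h3 = y0 \<and> 2 * y0 = N + 1"
    then show ?thesis
      using 1 2 3 unresolved_two_centres by simp
  next
    assume "h1 = y0 \<and> 2 * y0 = N + 1" "2 * h2 \<le> N" "h3 = y0 \<and> 2 * y0 = N + 1"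
    then show ?thesis
      using 1 2 3 unresolved_two_centres[of h2 p2 p1 p3] by (simp add: insert_commute)
  next
    assume "h1 = y0 \<and> 2 * y0 = N + 1" "h2 = y0 \<and> 2 * y0 = N + 1" "2 * h3 \<le> N"
    then show ?thesis
      using 1 2 3 unresolved_two_centres[of h3 p3 p1 p2] by (simp add: insert_commute)
  next
    assume "h1 = y0 \<and> 2 * y0 = N + 1" "h2 = y0 \<and> 2 * y0 = N + 1" "h3 = y0 \<and> 2 * y0 = N + 1"
    then show ?thesis
      using 1 2 3 unresolved_two_centres by simp
  qed
qed

lemma length_resolving_set:
  assumes "resolving_set G W"
  shows "4 \<le> length W"
proof (rule ccontr)
  assume "\<not> 4 \<le> length W"
  then have len: "length W \<le> 3" by simp
  have W: "set W \<subseteq> verts G" "inj_on (representation G W) (verts G)"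
    using assms by (simp_all add: resolving_set_def)
  have base: "(1, 1) \<in> verts G"
    using n2 mn by (simp add: verts_G)
  obtain a b c where abc: "set W \<subseteq> {a, b, c}" "{a, b, c} \<subseteq> insert (1, 1) (set W)"
    using set_subset_triple[OF len, of "(1, 1)"] by (elim exE conjE) (rule that)
  have "insert (1, 1) (set W) \<subseteq> verts G"
    using base W(1) by (rule insert_subsetI)
  with abc(2) have "{a, b, c} \<subseteq> verts G"
    by (rule subset_trans)
  then have "unresolved {a, b, c}"
    by (intro unresolved_triple) simp_all
  then obtain u v where uv: "u \<in> verts G" "v \<in> verts G" "u \<noteq> v"
    and abc_eq: "\<forall>w\<in>{a, b, c}. mdist u w = mdist v w"
    unfolding unresolved_def by (elim bexE conjE) (rule that)
  have "graph_dist G u w = graph_dist G v w" if "w \<in> set W" for w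
  proof -
    have "mdist u w = mdist v w"
      using abc_eq subsetD[OF abc(1) that] by (rule bspec)
    moreover have "w \<in> verts G" using W(1) that by (rule subsetD)
    ultimately have "int (graph_dist G u w) = int (graph_dist G v w)"
      using uv by (simp only: graph_dist_eq_mdist)
    then show ?thesis by simp
  qed
  then have "representation G W u = representation G W v"
    by (simp add: representation_def)
  with W(2) uv show False by (simp add: inj_on_def)
qed

section \<open>The four corners resolve\<close>

lemma resolving_set_corners: "resolving_set G [(1, 1), (1, n), (m - 1, 1), (m - 1, n)]"
proof -
  let ?W = "[(1, 1), (1, n), (m - 1, 1), (m - 1, n)]"
  have sub: "set ?W \<subseteq> verts G"
    using n2 mn by (simp add: verts_G)
  have "u = v" if uv: "u \<in> verts G" "v \<in> verts G"
    and eq: "representation G ?W u = representation G ?W v" for u v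
  proof -
    obtain i j k l where ijkl: "u = (i, j)" "v = (k, l)"
      by (metis surj_pair)
    have R: "1 \<le> i" "i \<le> m - 1" "1 \<le> j" "j \<le> n" "1 \<le> k" "k \<le> m - 1" "1 \<le> l" "l \<le> n"
      using uv ijkl by (simp_all add: verts_G)
    have md: "mdist u w = mdist v w" if "w \<in> set ?W" for w
      using eq that sub uv graph_dist_eq_mdist[of u w] graph_dist_eq_mdist[of v w]
      by (auto simp: representation_def)
    have corner: "mdist (i, j) (1, 1) = min (int i + int j - 2) (L + N - 1 - (int i + int j - 2))"
      "mdist (i, j) (1, n) = min (int i - int j + N - 1) (L + N - 1 - (int i - int j + N - 1))"
      "mdist (i, j) (m - 1, 1) = min (int i - int j + N) (L + N - 1 - (int i - int j + N))"
      "mdist (i, j) (m - 1, n) = min (int i + int j - 1) (L + N - 1 - (int i + int j - 1))"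
      if "1 \<le> i" "i \<le> m - 1" "1 \<le> j" "j \<le> n" for i j
    proof -
      have abs: "\<bar>int i - 1\<bar> = int i - 1" "\<bar>int i - L\<bar> = L - int i"
        "\<bar>int j - 1\<bar> = int j - 1" "\<bar>int j - N\<bar> = N - int j"
        "\<bar>int j + 1 - (N + 1)\<bar> = N - int j" "\<bar>int j + N - (N + 1)\<bar> = int j - 1"
        using that mn by auto
      have m1: "int (m - 1) = L" using mn by simp
      note md = mdist_def Let_def fst_conv snd_conv of_nat_1 m1 abs
      show "mdist (i, j) (1, 1) = min (int i + int j - 2) (L + N - 1 - (int i + int j - 2))"
        "mdist (i, j) (1, n) = min (int i - int j + N - 1) (L + N - 1 - (int i - int j + N - 1))"
        unfolding md by (rule arg_cong2[of _ _ _ _ min]; simp)+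
      show "mdist (i, j) (m - 1, 1) = min (int i - int j + N) (L + N - 1 - (int i - int j + N))"
        "mdist (i, j) (m - 1, n) = min (int i + int j - 1) (L + N - 1 - (int i + int j - 1))"
        unfolding md by (subst min.commute, rule arg_cong2[of _ _ _ _ min]; simp)+
    qed
    have min_eq: "a = b \<or> a + b = S" if "min a (S - a) = min b (S - b)" for a b S :: int
      using that by linarith
    \<comment> \<open>Each equation leaves equality or a reflection. The parameters at the two
      corners differ by one, so the two reflections would prescribe values of the sum differing by
      two and cannot both hold.\<close>
    have "int i + int j = int k + int l"
      using min_eq[OF md[of "(1, 1)", unfolded ijkl corner[OF R(1-4)] corner[OF R(5-8)]]]
        min_eq[OF md[of "(m - 1, n)", unfolded ijkl corner[OF R(1-4)] corner[OF R(5-8)]]]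
      by (simp, linarith)
    moreover have "int i - int j = int k - int l"
      using min_eq[OF md[of "(1, n)", unfolded ijkl corner[OF R(1-4)] corner[OF R(5-8)]]]
        min_eq[OF md[of "(m - 1, 1)", unfolded ijkl corner[OF R(1-4)] corner[OF R(5-8)]]]
      by (simp, linarith)
    ultimately show ?thesis by (simp add: ijkl)
  qed
  then show ?thesis
    using sub n2 mn by (auto simp: resolving_set_def inj_on_def)
qed

end

theorem theorem3p2:
  fixes m n :: nat
  assumes "n \<ge> 2" and "m \<ge> n + 4" and "even m \<longleftrightarrow> even n"
  shows "metric_dimension (with_proj (moebius_ladder m n)) = 4"
proof -
  interpret moebius m n
    using assms by unfold_locales
  show ?thesis
    unfolding metric_dimension_def
  proof (rule Least_equality)
    show "\<exists>W. resolving_set G W \<and> length W = 4"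
      using resolving_set_corners by fastforce
    show "4 \<le> k" if "\<exists>W. resolving_set G W \<and> length W = k" for k
      using that length_resolving_set by blast
  qed
qed

end
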